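(* Let $H$ and $K$ be complex inner product spaces such that $\dim(H)\ge 2$. Suppose that $A:H\to K$ is a non-zero additive mapping preserving Euclidean orthogonality. Then there exist a positive $\gamma\in\mathbb{R}$ and a real-linear isometry $T:H\to K$ such that $A=\gamma T$.
   Context: Inner product spaces are not assumed complete or finite dimensional. A mapping $A:H\to K$ is additive if $A(x+y)=A(x)+A(y)$ for all $x,y\in H$ (no homogeneity or continuity is assumed). It preserves (Euclidean) orthogonality if $\langle x|y\rangle=0$ in $H$ implies $\langle A(x)|A(y)\rangle=0$ in $K$, for all $x,y\in H$. Here $\dim(H)$ is the complex dimension. Isometries are not assumed surjective. *)

theory Defs
  imports "HOL-Analysis.Analysis"
begin

class complex_vector = scaleR + ab_group_add +
  fixes scaleC :: "complex \<Rightarrow> 'a \<Rightarrow> 'a" (infixr "*\<^sub>C" 75)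
  assumes scaleC_add_right: "a *\<^sub>C (x + y) = a *\<^sub>C x + a *\<^sub>C y"
    and scaleC_add_left: "(a + b) *\<^sub>C x = a *\<^sub>C x + b *\<^sub>C x"
    and scaleC_scaleC: "a *\<^sub>C (b *\<^sub>C x) = (a * b) *\<^sub>C x"
    and scaleC_one: "1 *\<^sub>C x = x"
    and scaleR_scaleC: "r *\<^sub>R x = complex_of_real r *\<^sub>C x"
begin

subclass real_vector
  by unfold_locales
    (simp_all add: scaleR_scaleC scaleC_add_right scaleC_add_left scaleC_scaleC scaleC_one)

end

global_interpretation complex_vector:
  vector_space "scaleC :: complex \<Rightarrow> 'a \<Rightarrow> 'a::complex_vector"
  by unfold_locales (simp_all add: scaleC_add_right scaleC_add_left scaleC_scaleC scaleC_one)

text \<open>The library's \<open>dim\<close> is 0 on spaces without a finite basis; here these get dimension \<open>\<infinity>\<close>.\<close>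

definition cdim :: "'a::complex_vector itself \<Rightarrow> enat" where
  "cdim _ =
    (if \<exists>B::'a set. finite B \<and> complex_vector.span B = UNIV
     then enat (complex_vector.dim (UNIV :: 'a set)) else \<infinity>)"

text \<open>Complex inner product spaces, not necessarily complete; the inner product is linear in its
  first argument. The real scalar multiplication, the norm and the topology are those induced by the
  complex structure, so the axioms inherited from \<^class>\<open>real_normed_vector\<close> restrict
  nothing: the triangle inequality is a consequence of the other axioms.\<close>

class complex_inner = complex_vector + real_normed_vector +
  fixes cinner :: "'a \<Rightarrow> 'a \<Rightarrow> complex"
  assumes cinner_commute: "cinner x y = cnj (cinner y x)"
    and cinner_add_left: "cinner (x + y) z = cinner x z + cinner y z"
    and cinner_scaleC_left: "cinner (a *\<^sub>C x) y = a * cinner x y"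
    and cinner_ge_zero: "0 \<le> Re (cinner x x)"
    and cinner_eq_zero_iff: "cinner x x = 0 \<longleftrightarrow> x = 0"
    and norm_eq_sqrt_cinner: "norm x = sqrt (Re (cinner x x))"

definition preserves_orthogonality :: "('a::complex_inner \<Rightarrow> 'b::complex_inner) \<Rightarrow> bool" where
  "preserves_orthogonality A \<longleftrightarrow> (\<forall>x y. cinner x y = 0 \<longrightarrow> cinner (A x) (A y) = 0)"

text \<open>Distance preserving, not necessarily surjective; \<^const>\<open>linear\<close> means linear over the reals.\<close>

definition real_linear_isometry :: "('a::complex_inner \<Rightarrow> 'b::complex_inner) \<Rightarrow> bool" where
  "real_linear_isometry T \<longleftrightarrow> linear T \<and> (\<forall>x y. dist (T x) (T y) = dist x y)"

end

theory Submission
  imports Defs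
begin

text \<open>
  Everything is deduced from the behaviour of \<open>q x = (norm (A x))\<^sup>2\<close>.

  If \<open>x\<close> and \<open>y\<close> are orthogonal and of equal norm, then \<open>x + y\<close> and \<open>x - y\<close> are orthogonal as
  well, so \<open>A x + A y\<close> and \<open>A x - A y\<close> are orthogonal, which says \<open>q x = q y\<close>. In dimension at least
  two, any two multiples \<open>a x\<close> and \<open>b x\<close> with \<open>\<bar>a\<bar> = \<bar>b\<bar>\<close> have a common orthogonal partner \<open>y\<close> of the same norm,
  hence \<open>q (a x)\<close> depends only on \<open>\<bar>a\<bar>\<close>; write it as \<open>\<psi> (\<bar>a\<bar>\<^sup>2)\<close>. The parallelogram law for
  \<open>A (\<surd>s x)\<close> and \<open>A (\<i> \<surd>t x)\<close> then reads \<open>\<psi> (s + t) = \<psi> s + \<psi> t\<close>, because both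
  \<open>\<surd>s + \<i> \<surd>t\<close> and \<open>\<surd>s - \<i> \<surd>t\<close> have squared modulus \<open>s + t\<close>. So \<open>\<psi>\<close> is a nonnegative solution of
  Cauchy's equation and therefore linear: \<open>q (a x) = \<bar>a\<bar>\<^sup>2 q x\<close> (lemma \<open>norm_scaleC_image\<close>).
  Nonnegativity of \<open>q\<close> thus does the work that continuity of \<open>A\<close> would otherwise do.

  Splitting an arbitrary vector into its component along a fixed \<open>x\<close> and an orthogonal remainder,
  Pythagoras in both spaces shows that \<open>q\<close> is a constant multiple of \<open>(norm x)\<^sup>2\<close>
  (lemma \<open>norm_image_proportional\<close>). Finally, an additive map that multiplies all norms by a
  constant is automatically real-linear, since its values have prescribed real inner products
  (lemma \<open>linear_if_additive_scales_norm\<close>).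
\<close>

section \<open>Complex inner product spaces\<close>

lemma cinner_add_right:
  fixes x y z :: "'a::complex_inner"
  shows "cinner x (y + z) = cinner x y + cinner x z"
  by (metis cinner_add_left cinner_commute complex_cnj_add)

lemma cinner_scaleC_right:
  fixes x y :: "'a::complex_inner"
  shows "cinner x (a *\<^sub>C y) = cnj a * cinner x y"
  by (metis cinner_scaleC_left cinner_commute complex_cnj_mult)

lemma cinner_scaleR_left:
  fixes x y :: "'a::complex_inner"
  shows "cinner (r *\<^sub>R x) y = complex_of_real r * cinner x y"
  by (simp add: scaleR_scaleC cinner_scaleC_left)

lemma cinner_scaleR_right:
  fixes x y :: "'a::complex_inner"
  shows "cinner x (r *\<^sub>R y) = complex_of_real r * cinner x y"
  by (simp add: scaleR_scaleC cinner_scaleC_right)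

lemma cinner_minus_left:
  fixes x y :: "'a::complex_inner"
  shows "cinner (- x) y = - cinner x y"
  using cinner_scaleR_left[of "-1" x y] by simp

lemma cinner_minus_right:
  fixes x y :: "'a::complex_inner"
  shows "cinner x (- y) = - cinner x y"
  using cinner_scaleR_right[of x "-1" y] by simp

lemma cinner_diff_left:
  fixes x y z :: "'a::complex_inner"
  shows "cinner (x - y) z = cinner x z - cinner y z"
  using cinner_add_left[of x "- y" z] by (simp add: cinner_minus_left)

lemma cinner_diff_right:
  fixes x y z :: "'a::complex_inner"
  shows "cinner x (y - z) = cinner x y - cinner x z"
  using cinner_add_right[of x y "- z"] by (simp add: cinner_minus_right)

lemma cinner_orthogonal_sym:
  fixes x y :: "'a::complex_inner"
  shows "cinner x y = 0 \<longleftrightarrow> cinner y x = 0"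
  using cinner_commute[of x y] by auto

lemma norm_square_eq_Re_cinner:
  fixes x :: "'a::complex_inner"
  shows "(norm x)\<^sup>2 = Re (cinner x x)"
  by (simp add: norm_eq_sqrt_cinner cinner_ge_zero)

lemma cinner_self_eq_norm_square:
  fixes x :: "'a::complex_inner"
  shows "cinner x x = complex_of_real ((norm x)\<^sup>2)"
proof (rule complex_eqI)
  show "Im (cinner x x) = Im (complex_of_real ((norm x)\<^sup>2))"
    using arg_cong[OF cinner_commute[of x x], of Im] by simp
qed (simp add: norm_square_eq_Re_cinner)

lemma norm_scaleC:
  fixes x :: "'a::complex_inner"
  shows "norm (a *\<^sub>C x) = cmod a * norm x"
proof -
  have "complex_of_real ((norm (a *\<^sub>C x))\<^sup>2) = a * cnj a * cinner x x"
    unfolding cinner_self_eq_norm_square[symmetric]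
    by (simp add: cinner_scaleC_left cinner_scaleC_right mult.assoc)
  also have "\<dots> = complex_of_real ((cmod a * norm x)\<^sup>2)"
    by (simp add: complex_norm_square[symmetric] cinner_self_eq_norm_square power_mult_distrib)
  finally have "(norm (a *\<^sub>C x))\<^sup>2 = (cmod a * norm x)\<^sup>2"
    using of_real_eq_iff by blast
  then show ?thesis by (simp add: power2_eq_iff_nonneg)
qed

lemma norm_square_add:
  fixes x y :: "'a::complex_inner"
  shows "(norm (x + y))\<^sup>2 = (norm x)\<^sup>2 + (norm y)\<^sup>2 + 2 * Re (cinner x y)"
  using arg_cong[OF cinner_commute[of x y], of Re]
  by (simp add: norm_square_eq_Re_cinner cinner_add_left cinner_add_right)

lemma norm_square_diff:
  fixes x y :: "'a::complex_inner"
  shows "(norm (x - y))\<^sup>2 = (norm x)\<^sup>2 + (norm y)\<^sup>2 - 2 * Re (cinner x y)"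
  using norm_square_add[of x "- y"] by (simp add: cinner_minus_right)

lemma orthogonal_decomposition:
  fixes x z :: "'a::complex_inner"
  assumes "x \<noteq> 0"
  obtains a y where "z = a *\<^sub>C x + y" "cinner x y = 0"
proof
  let ?a = "cinner z x / cinner x x"
  show "z = ?a *\<^sub>C x + (z - ?a *\<^sub>C x)" by simp
  have "cinner (z - ?a *\<^sub>C x) x = 0"
    using assms by (simp add: cinner_diff_left cinner_scaleC_left cinner_eq_zero_iff)
  then show "cinner x (z - ?a *\<^sub>C x) = 0"
    using cinner_orthogonal_sym by blast
qed

lemma ex_orthogonal_same_norm:
  fixes x :: "'a::complex_inner"
  assumes dim: "cdim TYPE('a) \<ge> 2"
  obtains y where "cinner x y = 0" "norm y = norm x"
proof (cases "x = 0")
  case True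
  then show ?thesis
    using that[of 0] cinner_eq_zero_iff[of 0] by simp
next
  case False
  have "complex_vector.span {x} \<noteq> UNIV"
  proof
    assume span: "complex_vector.span {x} = UNIV"
    have "complex_vector.dim (UNIV :: 'a set) \<le> card {x}"
      using span by (intro complex_vector.dim_le_card) auto
    moreover have "cdim TYPE('a) = enat (complex_vector.dim (UNIV :: 'a set))"
      unfolding cdim_def using span by (auto intro!: exI[of _ "{x}"])
    ultimately show False
      using dim by (simp add: numeral_eq_enat)
  qed
  then obtain z where z: "z \<notin> complex_vector.span {x}" by blast
  obtain a w where w: "z = a *\<^sub>C x + w" "cinner x w = 0"
    using orthogonal_decomposition[OF False] .
  have "w \<noteq> 0"
    using z w(1) by (auto simp: complex_vector.span_singleton)
  then show ?thesis
    using that[of "(norm x / norm w) *\<^sub>R w"] w(2) by (simp add: cinner_scaleR_right)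
qed

section \<open>Nonnegative solutions of Cauchy's equation\<close>

text \<open>Nonnegativity makes \<open>\<psi>\<close> monotone, so \<open>n \<psi> s = \<psi> (n s)\<close> is trapped between the values of \<open>\<psi>\<close> at
  the integers next to \<open>n s\<close>. The error is bounded independently of \<open>n\<close>, which forces linearity.\<close>

lemma nonneg_Cauchy_equation_linear:
  fixes \<psi> :: "real \<Rightarrow> real"
  assumes nonneg: "\<And>s. s \<ge> 0 \<Longrightarrow> \<psi> s \<ge> 0"
    and add: "\<And>s t. s \<ge> 0 \<Longrightarrow> t \<ge> 0 \<Longrightarrow> \<psi> (s + t) = \<psi> s + \<psi> t"
    and "s \<ge> 0"
  shows "\<psi> s = s * \<psi> 1"
proof -
  have mono: "\<psi> u \<le> \<psi> v" if "0 \<le> u" "u \<le> v" for u v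
    using add[of u "v - u"] nonneg[of "v - u"] that by simp
  have zero: "\<psi> 0 = 0"
    using add[of 0 0] by simp
  have multiple: "\<psi> (real n * u) = real n * \<psi> u" if "u \<ge> 0" for n u
  proof (induction n)
    case (Suc n)
    then show ?case
      using add[of "real n * u" u] that by (simp add: algebra_simps)
  qed (simp add: zero)
  have bound: "real n * \<bar>\<psi> s - s * \<psi> 1\<bar> \<le> \<psi> 1" for n
  proof -
    define m where "m = nat \<lfloor>real n * s\<rfloor>"
    have ns: "0 \<le> real n * s" using \<open>s \<ge> 0\<close> by simp
    then have m: "real m \<le> real n * s" "real n * s \<le> real (Suc m)"
      unfolding m_def by linarith+
    have "real m * \<psi> 1 \<le> real n * \<psi> s"
      using mono[OF _ m(1)] multiple[of 1 m] multiple[OF \<open>s \<ge> 0\<close>, of n] by simp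
    moreover have "real n * \<psi> s \<le> real (Suc m) * \<psi> 1"
      using mono[OF ns m(2)] multiple[of 1 "Suc m"] multiple[OF \<open>s \<ge> 0\<close>, of n] by simp
    moreover have "real m * \<psi> 1 \<le> real n * s * \<psi> 1" "real n * s * \<psi> 1 \<le> real (Suc m) * \<psi> 1"
      using m nonneg[of 1] by (auto intro!: mult_right_mono)
    ultimately have "\<bar>real n * \<psi> s - real n * s * \<psi> 1\<bar> \<le> \<psi> 1"
      by (simp add: algebra_simps abs_le_iff)
    moreover have "\<bar>real n * \<psi> s - real n * s * \<psi> 1\<bar> = real n * \<bar>\<psi> s - s * \<psi> 1\<bar>"
      by (metis abs_mult abs_of_nat mult.assoc right_diff_distrib)
    ultimately show ?thesis by simp
  qed
  show ?thesis
  proof (rule ccontr)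
    assume "\<psi> s \<noteq> s * \<psi> 1"
    then obtain n where "\<psi> 1 < real n * \<bar>\<psi> s - s * \<psi> 1\<bar>"
      using reals_Archimedean3[of "\<bar>\<psi> s - s * \<psi> 1\<bar>"] by auto
    then show False using bound[of n] by simp
  qed
qed

section \<open>Additive maps that scale the norm\<close>

text \<open>Additivity and the norm of \<open>A (r x + x)\<close> determine the real inner product of \<open>A (r x)\<close> with \<open>A x\<close>;
  expanding the square of \<open>norm (A (r x) - r A x)\<close> with it gives \<open>0\<close>.\<close>

lemma linear_if_additive_scales_norm:
  fixes A :: "'a::complex_inner \<Rightarrow> 'b::complex_inner"
  assumes "Modules.additive A"
    and scale: "\<And>x. (norm (A x))\<^sup>2 = c * (norm x)\<^sup>2"
  shows "linear A"
proof (rule linearI)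
  interpret A: Modules.additive A by fact
  show "A (x + y) = A x + A y" for x y by (rule A.add)
  show "A (r *\<^sub>R x) = r *\<^sub>R A x" for r x
  proof -
    have norm_rx: "(norm (A (r *\<^sub>R x)))\<^sup>2 = r\<^sup>2 * (c * (norm x)\<^sup>2)"
      by (simp add: scale power_mult_distrib)
    have "A (r *\<^sub>R x) + A x = A ((r + 1) *\<^sub>R x)"
      by (simp add: A.add[symmetric] scaleR_add_left)
    then have "(norm (A (r *\<^sub>R x) + A x))\<^sup>2 = (r + 1)\<^sup>2 * (c * (norm x)\<^sup>2)"
      by (simp add: scale power_mult_distrib)
    then have Re: "Re (cinner (A (r *\<^sub>R x)) (A x)) = r * (c * (norm x)\<^sup>2)"
      unfolding norm_square_add norm_rx scale[of x] by (simp add: algebra_simps power2_eq_square)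
    have "(norm (A (r *\<^sub>R x) - r *\<^sub>R A x))\<^sup>2
        = r\<^sup>2 * (c * (norm x)\<^sup>2) + r\<^sup>2 * (c * (norm x)\<^sup>2) - 2 * (r * (r * (c * (norm x)\<^sup>2)))"
      unfolding norm_square_diff norm_rx
      by (simp add: cinner_scaleR_right Re power_mult_distrib scale)
    also have "\<dots> = 0" by (simp add: power2_eq_square)
    finally show ?thesis by simp
  qed
qed

section \<open>Additive maps preserving orthogonality\<close>

locale additive_orthogonality_preserver = Modules.additive A
  for A :: "'h::complex_inner \<Rightarrow> 'k::complex_inner" +
  assumes orthogonal_image: "cinner x y = 0 \<Longrightarrow> cinner (A x) (A y) = 0"
begin

lemma Pythagoras_image:
  assumes "cinner x y = 0"
  shows "(norm (A (x + y)))\<^sup>2 = (norm (A x))\<^sup>2 + (norm (A y))\<^sup>2"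
  using orthogonal_image[OF assms] by (simp add: add norm_square_add)

text \<open>The diagonals \<open>x + y\<close> and \<open>x - y\<close> of a square are orthogonal, and conversely a rectangle with
  orthogonal diagonals is a square.\<close>

lemma norm_image_eq_if_orthogonal:
  assumes orth: "cinner x y = 0" and "norm x = norm y"
  shows "norm (A x) = norm (A y)"
proof -
  have yx: "cinner y x = 0"
    using orth cinner_orthogonal_sym by blast
  have "cinner (x + y) (x - y) = 0"
    using orth yx assms(2)
    by (simp add: cinner_add_left cinner_diff_right cinner_self_eq_norm_square)
  then have "cinner (A x + A y) (A x - A y) = 0"
    using orthogonal_image add diff by metis
  then have "complex_of_real ((norm (A x))\<^sup>2) = complex_of_real ((norm (A y))\<^sup>2)"
    using orthogonal_image[OF orth] orthogonal_image[OF yx]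
    by (simp add: cinner_add_left cinner_diff_right cinner_self_eq_norm_square)
  then show ?thesis
    by (metis of_real_eq_iff power2_eq_iff_nonneg norm_ge_zero)
qed

text \<open>Both multiples of \<open>x\<close> are compared with one vector orthogonal to \<open>x\<close>; this is the step that
  needs a second dimension.\<close>

lemma norm_image_scaleC_cong:
  assumes dim: "cdim TYPE('h) \<ge> 2" and ab: "cmod a = cmod b"
  shows "norm (A (a *\<^sub>C x)) = norm (A (b *\<^sub>C x))"
proof (cases "b = 0")
  case True
  with ab show ?thesis by simp
next
  case False
  obtain y where y: "cinner (b *\<^sub>C x) y = 0" "norm y = norm (b *\<^sub>C x)"
    using ex_orthogonal_same_norm[OF dim] .
  have "cinner (a *\<^sub>C x) y = 0"
    using y(1) False by (simp add: cinner_scaleC_left)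
  then show ?thesis
    using norm_image_eq_if_orthogonal[of "a *\<^sub>C x" y] norm_image_eq_if_orthogonal[OF y(1)] y(2) ab
    by (simp add: norm_scaleC)
qed

text \<open>As a function of \<open>(cmod a)\<^sup>2\<close>, the left-hand side solves Cauchy's equation by the parallelogram
  law in the target space.\<close>

lemma norm_scaleC_image:
  assumes dim: "cdim TYPE('h) \<ge> 2"
  shows "(norm (A (a *\<^sub>C x)))\<^sup>2 = (cmod a)\<^sup>2 * (norm (A x))\<^sup>2"
proof -
  define \<psi> where "\<psi> s = (norm (A (complex_of_real (sqrt s) *\<^sub>C x)))\<^sup>2" for s
  have \<psi>: "(norm (A (b *\<^sub>C x)))\<^sup>2 = \<psi> ((cmod b)\<^sup>2)" for b
    unfolding \<psi>_def
    using norm_image_scaleC_cong[OF dim, of b "complex_of_real (sqrt ((cmod b)\<^sup>2))" x] by simp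
  have "\<psi> (s + t) = \<psi> s + \<psi> t" if st: "s \<ge> 0" "t \<ge> 0" for s t
  proof -
    \<comment> \<open>A real and an imaginary scalar, so that their sum and their difference have the same modulus.\<close>
    let ?b = "complex_of_real (sqrt s)" and ?c = "\<i> * complex_of_real (sqrt t)"
    have moduli: "(cmod (?b + ?c))\<^sup>2 = s + t" "(cmod (?b - ?c))\<^sup>2 = s + t"
        "(cmod ?b)\<^sup>2 = s" "(cmod ?c)\<^sup>2 = t"
      using st by (simp_all add: cmod_power2)
    have "(norm (A (?b *\<^sub>C x) + A (?c *\<^sub>C x)))\<^sup>2 + (norm (A (?b *\<^sub>C x) - A (?c *\<^sub>C x)))\<^sup>2
        = 2 * (norm (A (?b *\<^sub>C x)))\<^sup>2 + 2 * (norm (A (?c *\<^sub>C x)))\<^sup>2"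
      by (simp add: norm_square_add norm_square_diff)
    moreover have "A (?b *\<^sub>C x) + A (?c *\<^sub>C x) = A ((?b + ?c) *\<^sub>C x)"
        "A (?b *\<^sub>C x) - A (?c *\<^sub>C x) = A ((?b - ?c) *\<^sub>C x)"
      by (simp_all only: add[symmetric] diff[symmetric] complex_vector.scale_left_distrib
          complex_vector.scale_left_diff_distrib)
    ultimately show ?thesis
      by (simp only: \<psi> moduli)
  qed
  then have "\<psi> ((cmod a)\<^sup>2) = (cmod a)\<^sup>2 * \<psi> 1"
    by (intro nonneg_Cauchy_equation_linear) (simp_all add: \<psi>_def)
  moreover have "\<psi> 1 = (norm (A x))\<^sup>2"
    using \<psi>[of 1] by (simp add: scaleC_one)
  ultimately show ?thesis by (simp add: \<psi>)
qed

lemma norm_image_proportional: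
  assumes dim: "cdim TYPE('h) \<ge> 2" and "x \<noteq> 0"
  shows "(norm (A z))\<^sup>2 = (norm (A x))\<^sup>2 / (norm x)\<^sup>2 * (norm z)\<^sup>2"
proof -
  obtain a y where z: "z = a *\<^sub>C x + y" and orth: "cinner x y = 0"
    using orthogonal_decomposition[OF \<open>x \<noteq> 0\<close>] .
  \<comment> \<open>The multiple of \<open>x\<close> that has the norm of \<open>y\<close> carries the size of \<open>A y\<close> back to that of \<open>A x\<close>.\<close>
  let ?r = "complex_of_real (norm y / norm x)"
  have "norm (A y) = norm (A (?r *\<^sub>C x))"
  proof (rule norm_image_eq_if_orthogonal[symmetric])
    show "cinner (?r *\<^sub>C x) y = 0" by (simp add: cinner_scaleC_left orth)
    show "norm (?r *\<^sub>C x) = norm y"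
      using \<open>x \<noteq> 0\<close> by (simp add: norm_scaleC norm_divide)
  qed
  then have y: "(norm (A y))\<^sup>2 = (norm y / norm x)\<^sup>2 * (norm (A x))\<^sup>2"
    by (simp add: norm_scaleC_image[OF dim] norm_divide)
  have ax_y: "cinner (a *\<^sub>C x) y = 0"
    by (simp add: cinner_scaleC_left orth)
  have "(norm z)\<^sup>2 = (cmod a)\<^sup>2 * (norm x)\<^sup>2 + (norm y)\<^sup>2"
    unfolding z by (simp add: norm_square_add ax_y norm_scaleC power_mult_distrib)
  moreover have "(norm (A z))\<^sup>2 = (cmod a)\<^sup>2 * (norm (A x))\<^sup>2 + (norm (A y))\<^sup>2"
    unfolding z by (simp add: Pythagoras_image[OF ax_y] norm_scaleC_image[OF dim])
  ultimately show ?thesis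
    using \<open>x \<noteq> 0\<close> by (simp add: y field_simps)
qed

end

section \<open>Rigidity of orthogonality preservers\<close>

theorem proposition2p1:
  fixes A :: "'h::complex_inner \<Rightarrow> 'k::complex_inner"
  assumes "cdim TYPE('h) \<ge> 2"
    and "Modules.additive A"
    and "A \<noteq> (\<lambda>x. 0)"
    and "preserves_orthogonality A"
  shows "\<exists>(\<gamma>::real) T. \<gamma> > 0 \<and> real_linear_isometry T \<and> A = (\<lambda>x. \<gamma> *\<^sub>R T x)"
proof -
  interpret A: Modules.additive A by fact
  interpret additive_orthogonality_preserver A
    using assms(4) by unfold_locales (simp add: preserves_orthogonality_def)
  obtain x where Ax: "A x \<noteq> 0" using assms(3) by blast
  then have x: "x \<noteq> 0" using A.zero by auto
  define \<gamma> where "\<gamma> = norm (A x) / norm x"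
  have pos: "\<gamma> > 0" unfolding \<gamma>_def using Ax x by simp
  have scale: "(norm (A z))\<^sup>2 = \<gamma>\<^sup>2 * (norm z)\<^sup>2" for z
    using norm_image_proportional[OF assms(1) x, of z] by (simp add: \<gamma>_def power_divide)
  have norm_A: "norm (A z) = \<gamma> * norm z" for z
    using scale[of z] pos by (simp add: power_mult_distrib[symmetric] power2_eq_iff_nonneg)
  let ?T = "\<lambda>z. (1 / \<gamma>) *\<^sub>R A z"
  have "linear ?T"
    using linear_if_additive_scales_norm[OF assms(2) scale] by (rule linear_compose_scale_right)
  moreover have "dist (?T u) (?T v) = dist u v" for u v
    using pos by (simp add: dist_norm scaleR_diff_right[symmetric] A.diff[symmetric] norm_A)
  ultimately have "real_linear_isometry ?T"
    by (simp add: real_linear_isometry_def)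
  moreover have "A = (\<lambda>z. \<gamma> *\<^sub>R ?T z)" using pos by auto
  ultimately show ?thesis using pos by blast
qed

end
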